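(* Let $m\ge1$ and $\kappa_m=\sqrt{\ln(4m)/\pi}$. The average number of nodes of the minimal dag of an $m$-labeled binary tree of size $n$, taken uniformly at random, satisfies $$\bar N^{\mathcal B}_{m,n}=2\kappa_m\frac{n}{\sqrt{\ln n}}\left(1+O\!\left(\frac1{\ln n}\right)\right)\quad(n\to\infty).$$
   Context: An $m$-labeled binary tree is a non-empty finite rooted tree with node labels in $\{1,\dots,m\}$ in which every node has an optional left and an optional right child (distinguished); its size is its number of edges. The number of nodes of its minimal dag is the number of distinct subtrees (subtree = a node with all its descendants). $\bar N^{\mathcal B}_{m,n}$ is the average of this quantity over all $m$-labeled binary trees of size $n$. *)

theory Defs
  imports Complex_Main "HOL-Library.Landau_Symbols"
begin

datatype btree = BNode nat "btree option" "btree option"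

fun labels :: "btree \<Rightarrow> nat set" where
  "labels (BNode a l r) =
     {a} \<union> (case l of None \<Rightarrow> {} | Some t \<Rightarrow> labels t)
         \<union> (case r of None \<Rightarrow> {} | Some t \<Rightarrow> labels t)"

fun nodes :: "btree \<Rightarrow> nat" where
  "nodes (BNode a l r) = 1 + (case l of None \<Rightarrow> 0 | Some t \<Rightarrow> nodes t)
                           + (case r of None \<Rightarrow> 0 | Some t \<Rightarrow> nodes t)"

text \<open>Size = number of edges = number of nodes minus one.\<close>
definition tsize :: "btree \<Rightarrow> nat" where
  "tsize t = nodes t - 1"

fun subtrees :: "btree \<Rightarrow> btree set" where
  "subtrees (BNode a l r) =
     {BNode a l r} \<union> (case l of None \<Rightarrow> {} | Some t \<Rightarrow> subtrees t)
                   \<union> (case r of None \<Rightarrow> {} | Some t \<Rightarrow> subtrees t)"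

text \<open>Number of nodes of the minimal dag = number of distinct subtrees.\<close>
definition dag_nodes :: "btree \<Rightarrow> nat" where
  "dag_nodes t = card (subtrees t)"

definition labeled_trees :: "nat \<Rightarrow> nat \<Rightarrow> btree set" where
  "labeled_trees m n = {t. labels t \<subseteq> {1..m} \<and> tsize t = n}"

definition avg_dag_nodes :: "nat \<Rightarrow> nat \<Rightarrow> real" where
  "avg_dag_nodes m n =
     (\<Sum>t\<in>labeled_trees m n. real (dag_nodes t)) / real (card (labeled_trees m n))"

end

theory Submission
  imports Defs "HOL-Computational_Algebra.Formal_Power_Series" "HOL-Analysis.Gamma_Function"
    "HOL-Real_Asymp.Real_Asymp"
begin

text \<open>
  Let $N = n + 1$ be the number of nodes, $b_k = 4^{-k}\binom{2k}{k}$ and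
  $K = \lfloor \log_{4m} N \rfloor$. A subtree with $k \le K$ nodes is one of
  $(4m)^k b_k/(k+1)$ possibilities, and all these together are negligible. Among the subtrees with
  more than $K$ nodes repetitions are rare: the number of distinct ones lies between the number
  of occurrences and that number minus the number of pairs of equal occurrences.
  Both have exact means, since the generating functions of the occurrences and pairs
  of occurrences of a fixed tree with $k$ nodes are $x^k W$ and $x^{2k+1} W'/2$, where
  $W = (1-4mx)^{-1/2}$. The mean number of occurrences of trees with $k$ nodes is close to
  $N b_k/(k+1) = 2N(b_k - b_{k+1})$, which telescopes to $2 N b_{K+1}$ over $k > K$, and
  Wallis' product gives $b_k \sim 1/\sqrt{\pi k}$.
\<close>

unbundle no vec_syntax
unbundle fps_syntax

section \<open>Normalised central binomial coefficients\<close>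

text \<open>These are the b_n = binom(2n, n) / 4^n of the overview. The product form gives the
  one-step recurrence and matches the partial products of Wallis.\<close>

definition wallis_ratio :: "nat \<Rightarrow> real" where
  "wallis_ratio n = (\<Prod>k=1..n. (2 * real k - 1) / (2 * real k))"

lemma wallis_ratio_0 [simp]: "wallis_ratio 0 = 1"
  by (simp add: wallis_ratio_def)

lemma wallis_ratio_Suc:
  "wallis_ratio (Suc n) = wallis_ratio n * (2 * real n + 1) / (2 * real n + 2)"
  by (simp add: wallis_ratio_def algebra_simps)

lemma wallis_ratio_pos: "wallis_ratio n > 0"
  by (induction n) (simp_all add: wallis_ratio_Suc)

lemma Suc_times_wallis_ratio:
  "real (Suc n) * wallis_ratio (Suc n) = (real n + 1/2) * wallis_ratio n"
  by (simp add: wallis_ratio_Suc field_simps)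

lemma wallis_ratio_diff:
  "wallis_ratio n - wallis_ratio (Suc n) = wallis_ratio n / (2 * (real n + 1))"
  by (simp add: wallis_ratio_Suc field_simps)

lemma decseq_wallis_ratio: "decseq wallis_ratio"
proof (rule decseq_SucI)
  fix n
  have "wallis_ratio n / (2 * (real n + 1)) \<ge> 0"
    using wallis_ratio_pos[of n] by simp
  then show "wallis_ratio (Suc n) \<le> wallis_ratio n"
    using wallis_ratio_diff[of n] by linarith
qed

lemma wallis_ratio_le_Suc: "wallis_ratio n \<le> 2 * wallis_ratio (Suc n)"
  using wallis_ratio_pos[of n] by (simp add: wallis_ratio_Suc field_simps)

text \<open>Passing to n + 1 replaces n b_n by (n + 1/2) b_n. The monotonicity later bounds b_{n-k}
  / b_n by n / (n - k) and controls the pair counts.\<close>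

lemma incseq_times_wallis_ratio: "incseq (\<lambda>n. real n * wallis_ratio n)"
  using wallis_ratio_pos[THEN less_imp_le] by (intro incseq_SucI) (simp add: wallis_ratio_Suc field_simps)

text \<open>The increasing sequence n b_n has the value 1/2 at n = 1. The bound serves to charge an
  error without a factor b to the main term.\<close>

lemma wallis_ratio_ge: "wallis_ratio (Suc n) \<ge> 1 / (2 * (real n + 1))"
  using incseqD[OF incseq_times_wallis_ratio, of 1 "Suc n"] wallis_ratio_Suc[of 0]
  by (simp add: pos_divide_le_eq algebra_simps)

text \<open>By \<open>wallis_ratio_diff\<close> the summand is 2 (b_k - b_{k+1}), and 2 b_1 = 1. The
  deficit 2 b_{n+1} becomes the main term of the average.\<close>

lemma sum_wallis_ratio:
  "(\<Sum>k=1..n. wallis_ratio k / (real k + 1)) = 1 - 2 * wallis_ratio (Suc n)"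
proof (induction n)
  case (Suc n)
  have "wallis_ratio (Suc n) / (real (Suc n) + 1) = 2 * (wallis_ratio (Suc n) - wallis_ratio (Suc (Suc n)))"
    unfolding wallis_ratio_diff by (simp add: divide_simps)
  then show ?case using Suc by (simp add: algebra_simps)
qed (simp add: wallis_ratio_Suc)

lemma wallis_ratio_square_tendsto: "(\<lambda>n. (wallis_ratio n)\<^sup>2 * (real n + 1/2)) \<longlonglongrightarrow> 1 / pi"
proof -
  \<comment> \<open>Each partial product of Wallis is exactly the inverse of 2 b_n^2 (n + 1/2), so
    the limit pi/2 transfers directly.\<close>
  have eq: "(\<Prod>k=1..n. (4 * real k ^ 2) / (4 * real k ^ 2 - 1)) =
      inverse (2 * ((wallis_ratio n)\<^sup>2 * (real n + 1/2)))" for n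
  proof (induction n)
    case (Suc n)
    let ?w = "wallis_ratio n"
    have "4 * (real (Suc n))\<^sup>2 - 1 = (2 * real n + 1) * (2 * real n + 3)"
      by (simp add: power2_eq_square algebra_simps)
    then have "(\<Prod>k=1..Suc n. (4 * real k ^ 2) / (4 * real k ^ 2 - 1)) =
        inverse (2 * (?w\<^sup>2 * (real n + 1/2))) *
        ((2 * real n + 2)\<^sup>2 / ((2 * real n + 1) * (2 * real n + 3)))"
      using Suc by (simp add: power2_eq_square algebra_simps)
    also have "\<dots> = inverse (?w\<^sup>2 * (2 * real n + 1) *
        ((2 * real n + 1) * (2 * real n + 3) / (2 * real n + 2)\<^sup>2))"
      by (simp add: divide_simps)
    also have "?w\<^sup>2 * (2 * real n + 1) * ((2 * real n + 1) * (2 * real n + 3) / (2 * real n + 2)\<^sup>2)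
        = 2 * ((wallis_ratio (Suc n))\<^sup>2 * (real (Suc n) + 1/2))"
      by (simp add: wallis_ratio_Suc power_divide power_mult_distrib)
         (simp add: divide_simps, simp add: algebra_simps power2_eq_square)
    finally show ?case .
  qed simp
  have "(\<lambda>n. inverse (inverse (2 * ((wallis_ratio n)\<^sup>2 * (real n + 1/2)))) * (1/2))
      \<longlonglongrightarrow> inverse (pi / 2) * (1/2)"
    by (intro tendsto_intros wallis[unfolded eq]) simp_all
  then show ?thesis by (simp only: inverse_inverse_eq) simp
qed

text \<open>Turns the limit into an inequality for every n: with the shift 1/2 the sequence
  decreases, because (2n+1)(2n+3) <= (2n+2)^2.\<close>

lemma wallis_ratio_square_ge: "(wallis_ratio n)\<^sup>2 * (real n + 1/2) \<ge> 1 / pi"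
proof (rule decseq_ge[OF _ wallis_ratio_square_tendsto])
  show "decseq (\<lambda>n. (wallis_ratio n)\<^sup>2 * (real n + 1/2))"
  proof (rule decseq_SucI)
    fix n
    have "(2 * real n + 1) * (2 * real n + 3) \<le> (2 * real n + 2)\<^sup>2"
      by (simp add: power2_eq_square algebra_simps)
    then have "((wallis_ratio n)\<^sup>2 * (real n + 1/2)) *
        ((2 * real n + 1) * (2 * real n + 3) / (2 * real n + 2)\<^sup>2)
      \<le> ((wallis_ratio n)\<^sup>2 * (real n + 1/2)) * 1"
      by (intro mult_left_mono) (simp_all add: divide_simps)
    also have "((wallis_ratio n)\<^sup>2 * (real n + 1/2)) *
        ((2 * real n + 1) * (2 * real n + 3) / (2 * real n + 2)\<^sup>2) =
        (wallis_ratio (Suc n))\<^sup>2 * (real (Suc n) + 1/2)"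
      by (simp add: wallis_ratio_Suc divide_simps) (simp add: algebra_simps power2_eq_square)
    finally show "(wallis_ratio (Suc n))\<^sup>2 * (real (Suc n) + 1/2) \<le> (wallis_ratio n)\<^sup>2 * (real n + 1/2)"
      by simp
  qed
qed

text \<open>Dropping the shift keeps the limit but reverses the monotonicity, because n (2n+2) <=
  (2n+1)^2 / 2.\<close>

lemma wallis_ratio_square_le: "(wallis_ratio n)\<^sup>2 * real n \<le> 1 / pi"
proof (rule incseq_le)
  show "incseq (\<lambda>n. (wallis_ratio n)\<^sup>2 * real n)"
  proof (rule incseq_SucI)
    fix n
    have "real n * (2 * real n + 2) \<le> (2 * real n + 1)\<^sup>2 / 2"
      by (simp add: power2_eq_square algebra_simps)
    then have "(wallis_ratio n)\<^sup>2 * real n \<le>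
        (wallis_ratio n)\<^sup>2 * ((2 * real n + 1)\<^sup>2 / (2 * (2 * real n + 2)))"
      by (intro mult_left_mono) (simp_all add: pos_le_divide_eq mult_ac)
    also have "\<dots> = (wallis_ratio (Suc n))\<^sup>2 * real (Suc n)"
      by (simp add: wallis_ratio_Suc divide_simps) (simp add: algebra_simps power2_eq_square)
    finally show "(wallis_ratio n)\<^sup>2 * real n \<le> (wallis_ratio (Suc n))\<^sup>2 * real (Suc n)" .
  qed
  have "(\<lambda>n. real n / (real n + 1/2)) \<longlonglongrightarrow> 1"
    by real_asymp
  from tendsto_mult[OF wallis_ratio_square_tendsto this]
  show "(\<lambda>n. (wallis_ratio n)\<^sup>2 * real n) \<longlonglongrightarrow> 1 / pi"
    by (simp add: divide_simps add_nonneg_eq_0_iff)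
qed

section \<open>Trees graded by their number of nodes\<close>

definition trees :: "nat \<Rightarrow> nat \<Rightarrow> btree set" where
  "trees m n = {t. labels t \<subseteq> {1..m} \<and> nodes t = n}"

text \<open>Adjoining the empty tree makes the decomposition at the root a plain convolution.\<close>
definition otrees :: "nat \<Rightarrow> nat \<Rightarrow> btree option set" where
  "otrees m n = (if n = 0 then {None} else Some ` trees m n)"

lemma nodes_pos: "nodes t > 0"
  by (cases t) simp

lemma trees_0 [simp]: "trees m 0 = {}"
  using nodes_pos by (auto simp: trees_def)

lemma otrees_0 [simp]: "otrees m 0 = {None}"
  by (simp add: otrees_def)

lemma None_in_otrees: "None \<in> otrees m n \<longleftrightarrow> n = 0"
  by (auto simp: otrees_def)

lemma Some_in_otrees: "Some t \<in> otrees m n \<longleftrightarrow> t \<in> trees m n"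
  by (auto simp: otrees_def)

lemma labeled_trees_eq: "labeled_trees m n = trees m (Suc n)"
proof -
  have "nodes t - 1 = n \<longleftrightarrow> nodes t = Suc n" for t
    using nodes_pos[of t] by linarith
  then show ?thesis
    by (simp add: labeled_trees_def trees_def tsize_def)
qed

lemma BNode_in_trees:
  "BNode a l r \<in> trees m (Suc n) \<longleftrightarrow>
     a \<in> {1..m} \<and> (\<exists>i\<le>n. l \<in> otrees m i \<and> r \<in> otrees m (n - i))"
  (is "_ \<longleftrightarrow> ?R")
proof
  assume "BNode a l r \<in> trees m (Suc n)"
  then show ?R
    by (intro conjI exI[of _ "case l of None \<Rightarrow> 0 | Some t \<Rightarrow> nodes t"])
       (auto simp: trees_def otrees_def nodes_pos less_imp_neq[OF nodes_pos, symmetric]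
             split: option.splits)
next
  assume ?R
  then show "BNode a l r \<in> trees m (Suc n)"
    by (cases l; cases r) (auto simp: Some_in_otrees None_in_otrees trees_def)
qed

lemma otrees_disjoint: "t \<in> otrees m i \<Longrightarrow> t \<in> otrees m j \<Longrightarrow> i = j"
  by (cases t) (auto simp: None_in_otrees Some_in_otrees trees_def)

text \<open>The size i in the tuple is determined by l through \<open>otrees_disjoint\<close>, so
  injectivity is kept. The bijection yields both finiteness and the rule for summing over root
  decompositions.\<close>

lemma bij_betw_trees_Suc:
  "bij_betw (\<lambda>(i, a, l, r). BNode a l r)
     (SIGMA i:{..n}. {1..m} \<times> otrees m i \<times> otrees m (n - i)) (trees m (Suc n))"
  unfolding bij_betw_def
proof
  show "inj_on (\<lambda>(i, a, l, r). BNode a l r)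
      (SIGMA i:{..n}. {1..m} \<times> otrees m i \<times> otrees m (n - i))"
    by (auto simp: inj_on_def dest: otrees_disjoint)
  show "(\<lambda>(i, a, l, r). BNode a l r) ` (SIGMA i:{..n}. {1..m} \<times> otrees m i \<times> otrees m (n - i))
      = trees m (Suc n)"
  proof (intro set_eqI iffI)
    fix t assume t: "t \<in> trees m (Suc n)"
    obtain a l r where "t = BNode a l r" by (cases t)
    with t show "t \<in> (\<lambda>(i, a, l, r). BNode a l r) `
        (SIGMA i:{..n}. {1..m} \<times> otrees m i \<times> otrees m (n - i))"
      by (force simp: BNode_in_trees image_iff)
  qed (auto simp: BNode_in_trees)
qed

lemma finite_otrees: "finite (otrees m n)"
proof (induction n rule: less_induct)
  case (less n)
  show ?case
  proof (cases n)
    case (Suc k)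
    have "finite (SIGMA i:{..k}. {1..m} \<times> otrees m i \<times> otrees m (k - i))"
      using less Suc by (intro finite_SigmaI finite_cartesian_product) auto
    then have "finite (trees m n)"
      using bij_betw_finite[OF bij_betw_trees_Suc] Suc by blast
    then show ?thesis by (simp add: otrees_def)
  qed simp
qed

lemma finite_trees: "finite (trees m n)"
proof -
  have "trees m n = the ` (otrees m n \<inter> range Some)"
    by (force simp: Some_in_otrees image_iff)
  then show ?thesis using finite_otrees by simp
qed

lemma sum_trees_Suc:
  fixes f :: "btree \<Rightarrow> real"
  shows "(\<Sum>t\<in>trees m (Suc n). f t) =
    (\<Sum>i\<le>n. \<Sum>a\<in>{1..m}. \<Sum>l\<in>otrees m i. \<Sum>r\<in>otrees m (n - i). f (BNode a l r))"
  unfolding sum.reindex_bij_betw[OF bij_betw_trees_Suc, symmetric]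
  by (simp add: sum.Sigma finite_otrees case_prod_unfold)

section \<open>Weighted generating functions\<close>

text \<open>The exponent is the number of nodes. Weights live on optional trees, so that the weight
  of the empty tree is the constant coefficient.\<close>

definition tree_gf :: "nat \<Rightarrow> (btree option \<Rightarrow> real) \<Rightarrow> real fps" where
  "tree_gf m f = Abs_fps (\<lambda>n. \<Sum>t\<in>otrees m n. f t)"

lemma tree_gf_nth: "tree_gf m f $ n = (\<Sum>t\<in>otrees m n. f t)"
  by (simp add: tree_gf_def)

lemma tree_gf_nth_Suc: "tree_gf m f $ Suc n = (\<Sum>t\<in>trees m (Suc n). f (Some t))"
  by (simp add: tree_gf_nth otrees_def sum.reindex)

lemma tree_gf_nth_pos: "n > 0 \<Longrightarrow> tree_gf m f $ n = (\<Sum>t\<in>trees m n. f (Some t))"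
  by (cases n) (simp_all add: tree_gf_nth_Suc)

lemma tree_gf_mult_nth:
  "real m * (tree_gf m g * tree_gf m h) $ n =
    (\<Sum>i\<le>n. \<Sum>a\<in>{1..m}. \<Sum>l\<in>otrees m i. \<Sum>r\<in>otrees m (n - i). g l * h r)"
proof -
  have "(\<Sum>a\<in>{1..m}. \<Sum>l\<in>A. \<Sum>r\<in>B. g l * h r) = real m * (sum g A * sum h B)" for A B
    by (simp add: sum_product)
  then show ?thesis
    by (simp only: fps_mult_nth tree_gf_nth sum_distrib_left atLeast0AtMost)
qed

lemma tree_gf_add: "tree_gf m (\<lambda>t. f t + g t) = tree_gf m f + tree_gf m g"
  by (simp add: fps_eq_iff tree_gf_nth sum.distrib)

section \<open>Occurrences of a fixed subtree\<close>

fun occ :: "btree \<Rightarrow> btree \<Rightarrow> nat" where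
  "occ s (BNode a l r) = (if s = BNode a l r then 1 else 0)
     + (case l of None \<Rightarrow> 0 | Some t \<Rightarrow> occ s t)
     + (case r of None \<Rightarrow> 0 | Some t \<Rightarrow> occ s t)"

definition oocc :: "btree \<Rightarrow> btree option \<Rightarrow> nat" where
  "oocc s t = (case t of None \<Rightarrow> 0 | Some t \<Rightarrow> occ s t)"

lemma oocc_simps [simp]: "oocc s None = 0" "oocc s (Some t) = occ s t"
  by (simp_all add: oocc_def)

lemma occ_BNode: "occ s (BNode a l r) = (if s = BNode a l r then 1 else 0) + oocc s l + oocc s r"
  by (simp add: oocc_def)

declare occ.simps [simp del]

lemma occ_eq_0: "nodes t < nodes s \<Longrightarrow> occ s t = 0"
  by (induction s t rule: occ.induct)
     (auto simp: occ_BNode oocc_def split: option.splits)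

lemma occ_self_children: "oocc (BNode a l r) l = 0" "oocc (BNode a l r) r = 0"
  by (auto simp: oocc_def occ_eq_0 split: option.splits)

lemma subtrees_iff_occ: "s \<in> subtrees t \<longleftrightarrow> occ s t > 0"
  by (induction s t rule: occ.induct)
     (auto simp: occ_BNode oocc_def split: option.splits)

lemma subtrees_in_trees:
  "s \<in> subtrees t \<Longrightarrow> labels t \<subseteq> {1..m} \<Longrightarrow> s \<in> trees m (nodes s) \<and> nodes s \<le> nodes t"
proof (induction t rule: subtrees.induct)
  case (1 a l r)
  have l: "s \<in> trees m (nodes s) \<and> nodes s \<le> nodes u" if "l = Some u" "s \<in> subtrees u" for u
    using 1 that by simp
  have r: "s \<in> trees m (nodes s) \<and> nodes s \<le> nodes u" if "r = Some u" "s \<in> subtrees u" for u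
    using 1 that by simp
  consider "s = BNode a l r" | u where "l = Some u" "s \<in> subtrees u"
    | u where "r = Some u" "s \<in> subtrees u"
    using 1(3) by (auto split: option.splits)
  then show ?case
  proof cases
    case 1
    then show ?thesis using \<open>labels (BNode a l r) \<subseteq> {1..m}\<close> by (simp only: trees_def) simp
  next
    case 2
    then show ?thesis using l[OF 2] by simp
  next
    case 3
    then show ?thesis using r[OF 3] by simp
  qed
qed

lemma finite_subtrees: "finite (subtrees t)"
  by (induction t rule: subtrees.induct) (auto split: option.splits)

text \<open>Trades a sum over a set depending on t for one over a fixed index range, which can be
  cut at a size K and averaged over t term by term.\<close>

lemma sum_subtrees:
  fixes f :: "btree \<Rightarrow> real"
  assumes "t \<in> trees m n" and "\<And>s. s \<notin> subtrees t \<Longrightarrow> f s = 0"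
  shows "(\<Sum>k=1..n. \<Sum>s\<in>trees m k. f s) = sum f (subtrees t)"
proof -
  have "(\<Sum>k=1..n. \<Sum>s\<in>trees m k. f s) = sum f (\<Union>k\<in>{1..n}. trees m k)"
    by (rule sum.UNION_disjoint[symmetric]) (auto simp: finite_trees, auto simp: trees_def)
  also have "\<dots> = sum f (subtrees t)"
  proof (rule sum.mono_neutral_right)
    have "nodes s \<in> {1..n}" "s \<in> trees m (nodes s)" if "s \<in> subtrees t" for s
      using subtrees_in_trees[OF that, of m] assms(1) nodes_pos[of s] by (auto simp: trees_def)
    then show "subtrees t \<subseteq> (\<Union>k\<in>{1..n}. trees m k)" by blast
  qed (auto simp: finite_trees assms(2))
  finally show ?thesis .
qed

text \<open>Each node is the root of an occurrence of exactly one tree. The superset A lets the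
  induction hypothesis apply to both children with the same A.\<close>

lemma sum_occ: 
  assumes "finite A" "subtrees t \<subseteq> A"
  shows "(\<Sum>s\<in>A. occ s t) = nodes t"
  using assms(2)
proof (induction t rule: subtrees.induct)
  case (1 a l r)
  have "(\<Sum>s\<in>A. oocc s l) = (case l of None \<Rightarrow> 0 | Some t \<Rightarrow> nodes t)"
    using 1 by (cases l) auto
  moreover have "(\<Sum>s\<in>A. oocc s r) = (case r of None \<Rightarrow> 0 | Some t \<Rightarrow> nodes t)"
    using 1 by (cases r) auto
  moreover have "(\<Sum>s\<in>A. if s = BNode a l r then 1 else 0 :: nat) = 1"
    using 1(3) assms(1) by simp
  ultimately show ?case by (simp add: occ_BNode sum.distrib)
qed

lemma sum_trees_occ:
  assumes "t \<in> trees m n"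
  shows "(\<Sum>k=1..n. \<Sum>s\<in>trees m k. real (occ s t)) = real n"
proof -
  have "(\<Sum>k=1..n. \<Sum>s\<in>trees m k. real (occ s t)) = (\<Sum>s\<in>subtrees t. real (occ s t))"
    by (rule sum_subtrees[OF assms]) (simp add: subtrees_iff_occ)
  also have "\<dots> = real (nodes t)"
    using sum_occ[OF finite_subtrees order_refl, of t] by (metis of_nat_sum)
  finally show ?thesis using assms by (simp add: trees_def)
qed

lemma dag_nodes_eq_sum:
  assumes "t \<in> trees m n"
  shows "real (dag_nodes t) = (\<Sum>k=1..n. \<Sum>s\<in>trees m k. of_bool (occ s t > 0))"
  unfolding dag_nodes_def
  by (subst sum_subtrees[OF assms]) (auto simp: subtrees_iff_occ simp flip: subtrees_iff_occ)

section \<open>Functional equations from the decomposition at the root\<close>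

text \<open>Weights that factor over the two children. Each functional equation arises by writing a
  weight as a sum of such products and, where present, an indicator of a single tree.\<close>

fun node_prod :: "(btree option \<Rightarrow> real) \<Rightarrow> (btree option \<Rightarrow> real) \<Rightarrow> btree option \<Rightarrow> real" where
  "node_prod g h None = 0"
| "node_prod g h (Some (BNode a l r)) = g l * h r"

lemma tree_gf_node_prod:
  "tree_gf m (node_prod g h) = of_nat m * fps_X * (tree_gf m g * tree_gf m h)"
proof (rule fps_ext)
  fix n
  show "tree_gf m (node_prod g h) $ n = (of_nat m * fps_X * (tree_gf m g * tree_gf m h)) $ n"
  proof (cases n)
    case 0
    then show ?thesis by (simp add: tree_gf_nth)
  next
    case (Suc k)
    then show ?thesis
      using tree_gf_mult_nth[of m g h k]
      by (simp add: tree_gf_nth_Suc sum_trees_Suc fps_of_nat[symmetric] mult.assoc)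
  qed
qed

lemma tree_gf_None: "tree_gf m (\<lambda>t. of_bool (t = None)) = 1"
proof (rule fps_ext)
  fix n
  show "tree_gf m (\<lambda>t. of_bool (t = None)) $ n = 1 $ n"
    by (cases n) (simp add: tree_gf_nth, simp add: tree_gf_nth_Suc)
qed

lemma tree_gf_Some:
  assumes "s \<in> trees m k"
  shows "tree_gf m (\<lambda>t. of_bool (t = Some s)) = fps_X ^ k"
proof (rule fps_ext)
  fix n
  show "tree_gf m (\<lambda>t. of_bool (t = Some s)) $ n = (fps_X ^ k :: real fps) $ n"
  proof (cases n)
    case 0
    then show ?thesis using assms by (cases k) (simp_all add: tree_gf_nth)
  next
    case (Suc j)
    have "s \<in> trees m n \<longleftrightarrow> n = k"
      using assms by (auto simp: trees_def)
    moreover have "(\<Sum>t\<in>trees m n. of_bool (t = s)) = (of_bool (s \<in> trees m n) :: real)"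
      by (simp add: of_bool_def finite_trees)
    ultimately show ?thesis
      by (simp add: Suc tree_gf_nth_Suc)
  qed
qed

abbreviation count_gf :: "nat \<Rightarrow> real fps" where
  "count_gf m \<equiv> tree_gf m (\<lambda>_. 1)"

abbreviation occ_gf :: "nat \<Rightarrow> btree \<Rightarrow> real fps" where
  "occ_gf m s \<equiv> tree_gf m (\<lambda>t. real (oocc s t))"

abbreviation occ_pair_gf :: "nat \<Rightarrow> btree \<Rightarrow> real fps" where
  "occ_pair_gf m s \<equiv> tree_gf m (\<lambda>t. real (oocc s t choose 2))"

lemma count_gf_eq: "count_gf m = 1 + of_nat m * fps_X * (count_gf m)\<^sup>2"
proof -
  have "(\<lambda>_. 1) = (\<lambda>t. of_bool (t = None) + node_prod (\<lambda>_. 1) (\<lambda>_. 1) t)"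
  proof
    fix t :: "btree option"
    show "1 = of_bool (t = None) + node_prod (\<lambda>_. 1) (\<lambda>_. 1) t"
      \<comment> \<open>The case rule of \<open>node_prod\<close>, applied to the argument triple,
        brings t into the form \<open>None\<close> or \<open>Some (BNode a l r)\<close>.\<close>
      by (cases "(\<lambda>_::btree option. 1::real, \<lambda>_::btree option. 1::real, t)" rule: node_prod.cases) auto
  qed
  then have "count_gf m = tree_gf m (\<lambda>t. of_bool (t = None) + node_prod (\<lambda>_. 1) (\<lambda>_. 1) t)"
    by (rule arg_cong)
  then show ?thesis
    by (simp add: tree_gf_add tree_gf_None tree_gf_node_prod power2_eq_square)
qed

text \<open>An occurrence of s sits at the root, in the left child or in the right child; in the
  last two cases the other child is arbitrary and contributes \<open>count_gf m\<close>.\<close>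

lemma occ_gf_eq:
  assumes "s \<in> trees m k"
  shows "occ_gf m s = fps_X ^ k + 2 * (of_nat m * fps_X * (count_gf m * occ_gf m s))"
proof -
  let ?f = "\<lambda>t. real (oocc s t)"
  have "?f = (\<lambda>t. of_bool (t = Some s) + (node_prod ?f (\<lambda>_. 1) t + node_prod (\<lambda>_. 1) ?f t))"
  proof
    fix t :: "btree option"
    show "?f t = of_bool (t = Some s) + (node_prod ?f (\<lambda>_. 1) t + node_prod (\<lambda>_. 1) ?f t)"
      by (cases "(?f, \<lambda>_::btree option. 1::real, t)" rule: node_prod.cases) (auto simp: occ_BNode)
  qed
  then have "occ_gf m s = tree_gf m
      (\<lambda>t. of_bool (t = Some s) + (node_prod ?f (\<lambda>_. 1) t + node_prod (\<lambda>_. 1) ?f t))"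
    by (rule arg_cong)
  then show ?thesis
    by (simp add: tree_gf_add tree_gf_Some[OF assms] tree_gf_node_prod algebra_simps)
qed

text \<open>A pair lies in the first part, lies in the second, or takes one element from each. The
  mixed pairs lead to the square of \<open>occ_gf m s\<close>.\<close>

lemma choose_2_add: "real ((x + y) choose 2) = real (x choose 2) + real (y choose 2) + real x * real y"
  by (induction x) (simp_all add: numeral_2_eq_2 algebra_simps)

text \<open>The root never contributes to a pair: if it is an occurrence, it is the only one.\<close>
lemma occ_pair_gf_eq:
  "occ_pair_gf m s = of_nat m * fps_X * (2 * (count_gf m * occ_pair_gf m s) + (occ_gf m s)\<^sup>2)"
proof -
  let ?f = "\<lambda>t. real (oocc s t)" and ?g = "\<lambda>t. real (oocc s t choose 2)"
  let ?h = "\<lambda>t. node_prod ?g (\<lambda>_. 1) t + (node_prod (\<lambda>_. 1) ?g t + node_prod ?f ?f t)"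
  have "?g = ?h"
  proof
    fix t :: "btree option"
    show "?g t = ?h t"
    proof (cases t)
      case None
      then show ?thesis by (simp add: numeral_2_eq_2)
    next
      case (Some u)
      obtain a l r where u: "u = BNode a l r" by (cases u)
      show ?thesis
      proof (cases "s = u")
        case True
        then have "oocc s l = 0" "oocc s r = 0"
          using u by (simp_all add: occ_self_children)
        then show ?thesis using True Some u by (simp add: occ_BNode numeral_2_eq_2)
      next
        case False
        then show ?thesis using Some u by (simp add: occ_BNode choose_2_add)
      qed
    qed
  qed
  then have "occ_pair_gf m s = tree_gf m ?h"
    by (rule arg_cong)
  then show ?thesis
    by (simp add: tree_gf_add tree_gf_node_prod algebra_simps power2_eq_square)
qed

section \<open>Closed forms of the generating functions\<close>

text \<open>The series W = (1 - 4mX)^(-1/2), given by its coefficients;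
  \<open>wallis_gf_square\<close> justifies the name.\<close>

definition wallis_gf :: "nat \<Rightarrow> real fps" where
  "wallis_gf m = Abs_fps (\<lambda>n. (4 * real m) ^ n * wallis_ratio n)"

text \<open>Gathers the constants into \<open>fps_const\<close>, so that the simplifier can read off
  coefficients.\<close>

lemma fps_scale_simps:
  fixes F :: "real fps"
  shows "4 * of_nat m * fps_X * F = fps_const (4 * real m) * (fps_X * F)"
    and "2 * of_nat m * fps_X * F = fps_const (2 * real m) * (fps_X * F)"
    and "2 * of_nat m * F = fps_const (2 * real m) * F"
  by (simp_all add: fps_of_nat[symmetric] numeral_fps_const mult.assoc[symmetric])

text \<open>Coefficientwise this is the recurrence \<open>Suc_times_wallis_ratio\<close>, multiplied
  by (4m)^(n+1).\<close>

lemma wallis_gf_deriv: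
  "(1 - 4 * of_nat m * fps_X) * fps_deriv (wallis_gf m) = 2 * of_nat m * wallis_gf m"
proof (rule fps_ext)
  fix n
  have "real (Suc n) * ((4 * real m) ^ Suc n * wallis_ratio (Suc n)) =
      (4 * real m) ^ Suc n * ((real n + 1/2) * wallis_ratio n)"
    by (simp only: Suc_times_wallis_ratio[symmetric] mult.left_commute)
  then have "real (Suc n) * ((4 * real m) ^ Suc n * wallis_ratio (Suc n)) =
      4 * real m * (real n * ((4 * real m) ^ n * wallis_ratio n)) + 2 * real m * ((4 * real m) ^ n * wallis_ratio n)"
    by (simp add: algebra_simps)
  moreover have "(fps_X * fps_deriv (wallis_gf m)) $ n = real n * ((4 * real m) ^ n * wallis_ratio n)"
    by (cases n) (simp_all add: wallis_gf_def)
  moreover have "fps_deriv (wallis_gf m) $ n = real (Suc n) * ((4 * real m) ^ Suc n * wallis_ratio (Suc n))"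
    by (simp add: wallis_gf_def)
  ultimately show "((1 - 4 * of_nat m * fps_X) * fps_deriv (wallis_gf m)) $ n = (2 * of_nat m * wallis_gf m) $ n"
    unfolding left_diff_distrib fps_scale_simps by (simp add: wallis_gf_def)
qed

text \<open>By the differential equation the left side has derivative 0, so it equals its constant
  coefficient.\<close>

lemma wallis_gf_square: "(wallis_gf m)\<^sup>2 * (1 - 4 * of_nat m * fps_X) = 1"
proof -
  let ?W = "wallis_gf m" and ?Q = "1 - 4 * of_nat m * fps_X :: real fps"
  have "fps_deriv (?W\<^sup>2 * ?Q) = 2 * ?W * (?Q * fps_deriv ?W) - 4 * of_nat m * ?W\<^sup>2"
    by (simp add: power2_eq_square algebra_simps)
  also have "\<dots> = 0"
    by (simp add: wallis_gf_deriv power2_eq_square)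
  finally have "?W\<^sup>2 * ?Q = fps_const ((?W\<^sup>2 * ?Q) $ 0)"
    by (rule fps_deriv_eq_0_iff[THEN iffD1])
  also have "(?W\<^sup>2 * ?Q) $ 0 = 1"
    by (simp add: wallis_gf_def power2_eq_square)
  finally show ?thesis by simp
qed

text \<open>Completing the square in \<open>count_gf_eq\<close> gives D^2 = 1 - 4mX for the second
  factor D, so the product squares to 1 and its constant coefficient picks the sign. Hence W inverts
  D, the factor of the unknown in the linear equations for occurrences and pairs.\<close>

lemma wallis_gf_count: "wallis_gf m * (1 - 2 * of_nat m * fps_X * count_gf m) = 1"
proof -
  let ?C = "count_gf m" and ?W = "wallis_gf m" and ?X = "of_nat m * fps_X :: real fps"
  let ?D = "1 - 2 * of_nat m * fps_X * ?C"
  have "?D\<^sup>2 = 1 - 4 * ?X * (?C - ?X * ?C\<^sup>2)"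
    by (simp add: power2_eq_square algebra_simps)
  also have "?C - ?X * ?C\<^sup>2 = 1"
    using count_gf_eq[of m] by (simp add: algebra_simps)
  finally have "(?W * ?D)\<^sup>2 = 1"
    using wallis_gf_square[of m] by (simp add: power_mult_distrib mult.assoc)
  then have "?W * ?D = 1 \<or> ?W * ?D = -1"
    by (simp add: power2_eq_1_iff)
  moreover have "?W * ?D \<noteq> -1"
  proof
    assume "?W * ?D = -1"
    then have "(?W * ?D) $ 0 = (-1) $ 0" by (rule arg_cong)
    then show False by (simp add: wallis_gf_def)
  qed
  ultimately show ?thesis by blast
qed

text \<open>From W D = 1 and W^2 (1 - 4mX) = 1 follows D = (1 - 4mX) W. Since
  \<open>count_gf m\<close> enters D with a factor X, its coefficient at n is found at n + 1, where
  b_n - b_{n+1} produces the denominator n + 1.\<close>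

lemma count_gf_nth: 
  assumes "m \<ge> 1"
  shows "count_gf m $ n = (4 * real m) ^ n * wallis_ratio n / (real n + 1)"
proof -
  let ?C = "count_gf m" and ?W = "wallis_gf m"
  have "(1 - 2 * of_nat m * fps_X * ?C) = ?W\<^sup>2 * (1 - 4 * of_nat m * fps_X) * (1 - 2 * of_nat m * fps_X * ?C)"
    by (simp add: wallis_gf_square)
  also have "\<dots> = ?W * (1 - 4 * of_nat m * fps_X) * (?W * (1 - 2 * of_nat m * fps_X * ?C))"
    by (simp only: power2_eq_square mult_ac)
  also have "\<dots> = (1 - 4 * of_nat m * fps_X) * ?W"
    by (simp add: wallis_gf_count)
  finally have "1 - fps_const (2 * real m) * (fps_X * ?C) = ?W - fps_const (4 * real m) * (fps_X * ?W)"
    unfolding left_diff_distrib fps_scale_simps by (simp add: mult.assoc)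
  from arg_cong[OF this, of "\<lambda>F. F $ Suc n"]
  have "2 * real m * ?C $ n = 4 * real m * ?W $ n - ?W $ Suc n"
    by simp
  also have "\<dots> = (4 * real m) ^ Suc n * (wallis_ratio n - wallis_ratio (Suc n))"
    by (simp add: wallis_gf_def algebra_simps)
  also have "\<dots> = 2 * real m * ((4 * real m) ^ n * wallis_ratio n / (real n + 1))"
    unfolding wallis_ratio_diff by (simp add: field_simps)
  finally show ?thesis using assms by (simp only: mult_cancel_left) simp
qed

lemma occ_gf_closed:
  assumes "s \<in> trees m k"
  shows "occ_gf m s = fps_X ^ k * wallis_gf m"
proof -
  let ?D = "1 - 2 * of_nat m * fps_X * count_gf m"
  have "?D * occ_gf m s = fps_X ^ k"
    using occ_gf_eq[OF assms] by (simp add: algebra_simps)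
  then have "fps_X ^ k * wallis_gf m = wallis_gf m * ?D * occ_gf m s"
    by (simp only: mult_ac)
  then show ?thesis by (simp add: wallis_gf_count)
qed

text \<open>Solving the linear equation for the pair series P with W = 1/D gives 2P = X^(2k) X (2m
  W^3), and 2m W^3 = W^2 (1 - 4mX) W' = W' by the differential equation.\<close>

lemma occ_pair_gf_closed:
  assumes "s \<in> trees m k"
  shows "2 * occ_pair_gf m s = fps_X ^ (2 * k) * (fps_X * fps_deriv (wallis_gf m))"
proof -
  let ?C = "count_gf m" and ?W = "wallis_gf m" and ?P = "occ_pair_gf m s"
  let ?D = "1 - 2 * of_nat m * fps_X * ?C" and ?Q = "1 - 4 * of_nat m * fps_X :: real fps"
  have "?D * ?P = of_nat m * fps_X * (occ_gf m s)\<^sup>2"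
    using occ_pair_gf_eq[of m s] by (simp add: algebra_simps)
  also have "\<dots> = of_nat m * fps_X * (fps_X ^ (2 * k) * ?W\<^sup>2)"
    by (simp add: occ_gf_closed[OF assms] power_mult_distrib power_mult[symmetric] mult.commute)
  finally have "2 * (?W * ?D * ?P) = fps_X ^ (2 * k) * (fps_X * (?W\<^sup>2 * (2 * of_nat m * ?W)))"
    by (simp add: mult_ac)
  also have "\<dots> = fps_X ^ (2 * k) * (fps_X * (?W\<^sup>2 * (?Q * fps_deriv ?W)))"
    by (simp only: wallis_gf_deriv)
  also have "\<dots> = fps_X ^ (2 * k) * (fps_X * (?W\<^sup>2 * ?Q * fps_deriv ?W))"
    by (simp only: mult.assoc)
  finally show ?thesis by (simp add: wallis_gf_count wallis_gf_square)
qed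

lemma sum_occ_trees:
  assumes "s \<in> trees m k" "k \<le> n" "n > 0"
  shows "(\<Sum>t\<in>trees m n. real (occ s t)) = (4 * real m) ^ (n - k) * wallis_ratio (n - k)"
proof -
  have "(\<Sum>t\<in>trees m n. real (occ s t)) = occ_gf m s $ n"
    using assms(3) by (simp add: tree_gf_nth_pos)
  then show ?thesis using assms(2)
    by (simp add: occ_gf_closed[OF assms(1)] fps_X_power_mult_nth wallis_gf_def)
qed

lemma sum_occ_pairs_trees:
  assumes "s \<in> trees m k" "n > 0"
  shows "(\<Sum>t\<in>trees m n. real (occ s t choose 2)) =
    (if n < 2 * k then 0 else (4 * real m) ^ (n - 2 * k) * (real (n - 2 * k) * wallis_ratio (n - 2 * k)) / 2)"
proof -
  have "2 * (\<Sum>t\<in>trees m n. real (occ s t choose 2)) = (2 * occ_pair_gf m s) $ n"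
    using assms(2) by (simp add: tree_gf_nth_pos numeral_fps_const)
  also have "\<dots> = (if n < 2 * k then 0 else (fps_X * fps_deriv (wallis_gf m)) $ (n - 2 * k))"
    unfolding occ_pair_gf_closed[OF assms(1)] by (simp add: fps_X_power_mult_nth)
  \<comment> \<open>X W' has the coefficient of W at j multiplied by j. Both sides are 0 at j = 0,
    where truncated subtraction also puts the case n < 2k.\<close>
  finally show ?thesis
    by (cases "n - 2 * k") (simp_all add: wallis_gf_def split: if_splits)
qed

section \<open>Tree counts and geometric sums\<close>

text \<open>This is m^n times the n-th Catalan number. At n = 0 it is 1, for the empty tree, whereas
  \<open>trees m 0\<close> is empty; hence the positivity condition in
  \<open>card_trees\<close>.\<close>

definition tree_count :: "nat \<Rightarrow> nat \<Rightarrow> real" where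
  "tree_count m n = (4 * real m) ^ n * wallis_ratio n / (real n + 1)"

lemma card_trees:
  assumes "m \<ge> 1" "n > 0"
  shows "real (card (trees m n)) = tree_count m n"
  using count_gf_nth[OF assms(1), of n] assms(2) by (simp add: tree_gf_nth_pos tree_count_def)

lemma tree_count_pos: "m \<ge> 1 \<Longrightarrow> tree_count m n > 0"
  using wallis_ratio_pos by (simp add: tree_count_def)

text \<open>The quotient of consecutive counts is 2m (2k+1) / (k+2), at least 2 from k = 1 on. Sums
  of counts are thus at most twice their last term.\<close>

lemma tree_count_Suc_ge:
  assumes "m \<ge> 1" "k \<ge> 1"
  shows "2 * tree_count m k \<le> tree_count m (Suc k)"
proof -
  have "tree_count m (Suc k) = tree_count m k * (real m * (2 * (2 * real k + 1) / (real k + 2)))"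
    by (simp add: tree_count_def wallis_ratio_Suc divide_simps) (simp add: algebra_simps)
  moreover have "1 * 2 \<le> real m * (2 * (2 * real k + 1) / (real k + 2))"
    using assms by (intro mult_mono) (auto simp: field_simps)
  ultimately show ?thesis
    using mult_left_mono[of 2 "real m * (2 * (2 * real k + 1) / (real k + 2))" "tree_count m k"]
      tree_count_pos[OF assms(1), of k] by simp
qed

lemma sum_tree_count_le:
  assumes "m \<ge> 1" "K \<ge> 1"
  shows "(\<Sum>k=1..K. tree_count m k) \<le> 2 * tree_count m K"
  using assms(2)
proof (induction K rule: nat_induct_at_least)
  case base
  then show ?case using tree_count_pos[OF assms(1), of 1] by simp
next
  case (Suc k)
  then show ?case using tree_count_Suc_ge[OF assms(1) Suc.hyps] by simp
qed

text \<open>The subtracted last term carries the induction: it absorbs the new summand because 2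
  x^(n+1) <= x^n.\<close>

lemma sum_power_le:
  fixes x :: real
  assumes "0 \<le> x" "x \<le> 1/2" "a \<le> n"
  shows "(\<Sum>k=a..n. x ^ k) \<le> 2 * x ^ a - x ^ n"
  using assms(3)
proof (induction n rule: nat_induct_at_least)
  case (Suc n)
  have "2 * x * x ^ n \<le> 1 * x ^ n"
    using assms by (intro mult_right_mono) auto
  then show ?case using Suc by simp
qed simp

section \<open>Mean numbers of occurrences and of pairs\<close>

definition mean_trees :: "nat \<Rightarrow> nat \<Rightarrow> (btree \<Rightarrow> real) \<Rightarrow> real" where
  "mean_trees m n f = (\<Sum>t\<in>trees m n. f t) / real (card (trees m n))"

lemma avg_dag_nodes_eq: "avg_dag_nodes m n = mean_trees m (Suc n) (\<lambda>t. real (dag_nodes t))"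
  by (simp add: avg_dag_nodes_def mean_trees_def labeled_trees_eq)

lemma mean_trees_mono:
  "(\<And>t. t \<in> trees m n \<Longrightarrow> f t \<le> g t) \<Longrightarrow> mean_trees m n f \<le> mean_trees m n g"
  unfolding mean_trees_def by (intro divide_right_mono sum_mono) auto

lemma mean_trees_diff: "mean_trees m n (\<lambda>t. f t - g t) = mean_trees m n f - mean_trees m n g"
  by (simp add: mean_trees_def sum_subtractf diff_divide_distrib)

lemma mean_trees_sum: "mean_trees m n (\<lambda>t. \<Sum>k\<in>A. f k t) = (\<Sum>k\<in>A. mean_trees m n (f k))"
  unfolding mean_trees_def by (subst sum.swap) (simp add: sum_divide_distrib)

lemma mean_trees_const:
  assumes "m \<ge> 1" "n > 0"
  shows "mean_trees m n (\<lambda>_. c) = c"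
proof -
  have "real (card (trees m n)) > 0"
    using assms tree_count_pos[OF assms(1)] by (simp only: card_trees)
  then show ?thesis by (simp add: mean_trees_def)
qed

text \<open>By \<open>sum_occ_trees\<close> the total depends on s only through its size, so summing
  over s multiplies by \<open>tree_count m k\<close>; the powers of 4m then cancel against
  \<open>tree_count m n\<close>.\<close>

lemma mean_occ:
  assumes "m \<ge> 1" "1 \<le> k" "k \<le> n"
  shows "mean_trees m n (\<lambda>t. \<Sum>s\<in>trees m k. real (occ s t)) =
    (real n + 1) * (wallis_ratio k / (real k + 1)) * (wallis_ratio (n - k) / wallis_ratio n)"
proof -
  have "(\<Sum>t\<in>trees m n. \<Sum>s\<in>trees m k. real (occ s t)) =
      (\<Sum>s\<in>trees m k. (4 * real m) ^ (n - k) * wallis_ratio (n - k))"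
    using assms by (subst sum.swap, intro sum.cong) (auto simp: sum_occ_trees)
  also have "\<dots> = tree_count m k * ((4 * real m) ^ (n - k) * wallis_ratio (n - k))"
    using assms by (simp add: card_trees)
  also have "\<dots> = (4 * real m) ^ (k + (n - k)) * (wallis_ratio k / (real k + 1) * wallis_ratio (n - k))"
    unfolding tree_count_def power_add by simp
  also have "k + (n - k) = n" using assms by simp
  finally show ?thesis
    using assms wallis_ratio_pos[of n]
    by (simp add: mean_trees_def card_trees tree_count_def divide_simps)
qed

text \<open>A pair takes up 2k nodes but involves only one choice of s, so the cancellation leaves a
  surplus factor (4m)^(-k). This decay makes repetitions of large trees rare.\<close>

lemma mean_occ_pairs_le:
  assumes "m \<ge> 1" "1 \<le> k" "n > 0"
  shows "mean_trees m n (\<lambda>t. \<Sum>s\<in>trees m k. real (occ s t choose 2)) \<le>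
    (real n + 1) * real n / 2 * (wallis_ratio k / (real k + 1)) * (1 / (4 * real m)) ^ k"
proof (cases "n < 2 * k")
  case True
  have "(\<Sum>t\<in>trees m n. \<Sum>s\<in>trees m k. real (occ s t choose 2)) =
      (\<Sum>s\<in>trees m k. \<Sum>t\<in>trees m n. real (occ s t choose 2))"
    by (rule sum.swap)
  also have "\<dots> = 0"
    using assms True by (intro sum.neutral) (auto simp: sum_occ_pairs_trees)
  finally show ?thesis
    using wallis_ratio_pos[of k] by (simp add: mean_trees_def)
next
  case False
  define j where "j = n - 2 * k"
  have n: "n = 2 * k + j" using False by (simp add: j_def)
  have "(\<Sum>t\<in>trees m n. \<Sum>s\<in>trees m k. real (occ s t choose 2)) =
      (\<Sum>s\<in>trees m k. (4 * real m) ^ j * (real j * wallis_ratio j) / 2)"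
    using assms False unfolding j_def
    by (subst sum.swap, intro sum.cong) (auto simp: sum_occ_pairs_trees)
  also have "\<dots> = tree_count m k * ((4 * real m) ^ j * (real j * wallis_ratio j) / 2)"
    using assms by (simp add: card_trees)
  \<comment> \<open>Replacing j b_j by the larger n b_n prepares the division by
    \<open>tree_count m n\<close>.\<close>
  also have "\<dots> \<le> tree_count m k * ((4 * real m) ^ j * (real n * wallis_ratio n) / 2)"
    using incseqD[OF incseq_times_wallis_ratio, of j n] tree_count_pos[OF assms(1), of k]
    by (intro mult_left_mono divide_right_mono) (auto simp: j_def)
  also have "\<dots> = tree_count m n * ((real n + 1) * real n / 2 * (wallis_ratio k / (real k + 1)) *
      (1 / (4 * real m)) ^ k)"
  proof -
    have "(4 * real m) ^ n = (4 * real m) ^ j * (4 * real m) ^ k * (4 * real m) ^ k"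
      by (simp add: n power_add mult_2)
    then have "tree_count m n = (4 * real m) ^ j * (4 * real m) ^ k * (4 * real m) ^ k *
        wallis_ratio n / (real n + 1)"
      by (simp add: tree_count_def)
    then show ?thesis using assms(1)
      by (simp only: tree_count_def[of m k]) (simp add: divide_simps)
  qed
  finally show ?thesis
    using assms tree_count_pos[OF assms(1), of n]
    by (simp add: mean_trees_def card_trees pos_divide_le_eq mult.commute)
qed

section \<open>Bounds on the average for a given cutoff K\<close>

lemma sum_split_at:
  fixes f :: "nat \<Rightarrow> real"
  shows "K \<le> n \<Longrightarrow> (\<Sum>k=1..n. f k) = (\<Sum>k=1..K. f k) + (\<Sum>k=K+1..n. f k)"
  using sum.ub_add_nat[of 1 K f "n - K"] by simp

text \<open>With N = n + 1, the occurrences of large trees are N minus those of small trees, so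
  means are taken only for k <= K, where b_{N-k} / b_N >= 1. As (4m)^K <= N, the number of small
  trees is at most 2 / (K+1) times the main term.\<close>

lemma avg_dag_nodes_le:
  assumes "m \<ge> 1" "1 \<le> K" "K \<le> Suc n" "(4 * real m) ^ K \<le> real (Suc n)"
  shows "avg_dag_nodes m n \<le>
    2 * real (Suc n) * wallis_ratio (Suc K) * (1 + 1 / real (Suc n) + 2 / (real K + 1))"
proof -
  let ?N = "Suc n" and ?w = "wallis_ratio (Suc K)"
  let ?occ = "\<lambda>k t. \<Sum>s\<in>trees m k. real (occ s t)"
  have dag_le: "real (dag_nodes t) \<le> ((\<Sum>k=1..K. tree_count m k) + real ?N) - (\<Sum>k=1..K. ?occ k t)"
    if t: "t \<in> trees m ?N" for t
  proof -
    have "real (dag_nodes t) = (\<Sum>k=1..K. \<Sum>s\<in>trees m k. of_bool (occ s t > 0))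
        + (\<Sum>k=K+1..?N. \<Sum>s\<in>trees m k. of_bool (occ s t > 0))"
      unfolding dag_nodes_eq_sum[OF t] by (rule sum_split_at[OF assms(3)])
    also have "\<dots> \<le> (\<Sum>k=1..K. \<Sum>s\<in>trees m k. 1) + (\<Sum>k=K+1..?N. ?occ k t)"
      by (intro add_mono sum_mono) (simp_all add: of_bool_def)
    also have "(\<Sum>k=1..K. \<Sum>s\<in>trees m k. 1) = (\<Sum>k=1..K. tree_count m k)"
      using assms(1) by (intro sum.cong) (simp_all add: card_trees)
    also have "(\<Sum>k=K+1..?N. ?occ k t) = real ?N - (\<Sum>k=1..K. ?occ k t)"
      using sum_trees_occ[OF t] sum_split_at[OF assms(3), of "\<lambda>k. ?occ k t"] by linarith
    finally show ?thesis by linarith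
  qed
  have "mean_trees m ?N (\<lambda>t. real (dag_nodes t)) \<le>
      mean_trees m ?N (\<lambda>t. ((\<Sum>k=1..K. tree_count m k) + real ?N) - (\<Sum>k=1..K. ?occ k t))"
    by (rule mean_trees_mono) (rule dag_le)
  then have "avg_dag_nodes m n \<le> ((\<Sum>k=1..K. tree_count m k) + real ?N) - (\<Sum>k=1..K. mean_trees m ?N (?occ k))"
    using assms(1) by (simp only: avg_dag_nodes_eq mean_trees_diff mean_trees_sum mean_trees_const zero_less_Suc)
  moreover have "(\<Sum>k=1..K. mean_trees m ?N (?occ k)) \<ge>
      (\<Sum>k=1..K. (real ?N + 1) * (wallis_ratio k / (real k + 1)))"
  proof (intro sum_mono)
    fix k assume k: "k \<in> {1..K}"
    have "wallis_ratio (?N - k) / wallis_ratio ?N \<ge> 1"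
      using decseqD[OF decseq_wallis_ratio, of "?N - k" ?N] wallis_ratio_pos[of ?N]
      by (simp add: pos_le_divide_eq)
    then have "(real ?N + 1) * (wallis_ratio k / (real k + 1)) * 1 \<le> 
      (real ?N + 1) * (wallis_ratio k / (real k + 1)) * (wallis_ratio (?N - k) / wallis_ratio ?N)"
      using wallis_ratio_pos[of k] by (intro mult_left_mono) auto
    then show "(real ?N + 1) * (wallis_ratio k / (real k + 1)) \<le> mean_trees m ?N (?occ k)"
      using k assms by (subst mean_occ) auto
  qed
  moreover have "(\<Sum>k=1..K. (real ?N + 1) * (wallis_ratio k / (real k + 1))) = (real ?N + 1) * (1 - 2 * ?w)"
    by (simp only: sum_distrib_left[symmetric] sum_wallis_ratio)
  moreover have "(\<Sum>k=1..K. tree_count m k) \<le> 4 * real ?N * ?w / (real K + 1)"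
  proof -
    have "tree_count m K = (4 * real m) ^ K * (wallis_ratio K / (real K + 1))"
      by (simp add: tree_count_def)
    also have "\<dots> \<le> real ?N * (2 * ?w / (real K + 1))"
      using wallis_ratio_le_Suc[of K] assms(4) wallis_ratio_pos[of K]
      by (intro mult_mono divide_right_mono) auto
    finally have "2 * tree_count m K \<le> 2 * (real ?N * (2 * ?w / (real K + 1)))"
      by (rule mult_left_mono) simp
    also have "\<dots> = 4 * real ?N * ?w / (real K + 1)"
      by (simp del: of_nat_Suc)
    finally show ?thesis
      by (rule order_trans[OF sum_tree_count_le[OF assms(1,2)]])
  qed
  ultimately have "avg_dag_nodes m n \<le> 4 * real ?N * ?w / (real K + 1) + real ?N - (real ?N + 1) * (1 - 2 * ?w)"
    by linarith
  \<comment> \<open>The terms N cancel, and the deficit of the telescoped sum remains as main term;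
    the -1 is dropped at the end.\<close>
  also have "\<dots> = 2 * real ?N * ?w + 2 * ?w + 4 * real ?N * ?w / (real K + 1) - 1"
    by (simp add: algebra_simps)
  also have "\<dots> = 2 * real ?N * ?w * (1 + 1 / real ?N + 2 / (real K + 1)) - 1"
    by (simp add: distrib_left del: of_nat_Suc)
  finally show ?thesis by simp
qed

text \<open>Small trees are only counted as nonnegative; large ones are counted by occurrences minus
  pairs. As (4m)^(K+1) >= N, the geometric sum over pairs costs at most 1 / (K+1) of the main term.
  The other error comes from bounding b_{N-k} / b_N by N / (N-K).\<close>

lemma avg_dag_nodes_ge:
  assumes "m \<ge> 1" "K < Suc n" "real (Suc n) \<le> (4 * real m) ^ Suc K"
  shows "avg_dag_nodes m n \<ge> 2 * real (Suc n) * wallis_ratio (Suc K) *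
    (1 - (real K + 1)\<^sup>2 / (real (Suc n) - real K) - 1 / (real K + 1))"
proof -
  let ?N = "Suc n" and ?w = "wallis_ratio (Suc K)"
  let ?occ = "\<lambda>k t. \<Sum>s\<in>trees m k. real (occ s t)"
  let ?prs = "\<lambda>k t. \<Sum>s\<in>trees m k. real (occ s t choose 2)"
  have K: "K \<le> ?N" using assms(2) by simp
  \<comment> \<open>The Bonferroni inequality: equality holds for x <= 2, and the left side is at
    most 0 beyond.\<close>
  have occ_le: "real x - real (x choose 2) \<le> of_bool (x > 0)" for x
    by (cases x) (simp_all add: numeral_2_eq_2)
  have dag_ge: "real ?N - (\<Sum>k=1..K. ?occ k t) - (\<Sum>k=K+1..?N. ?prs k t) \<le> real (dag_nodes t)"
    if t: "t \<in> trees m ?N" for t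
  proof -
    have "real ?N - (\<Sum>k=1..K. ?occ k t) = (\<Sum>k=K+1..?N. ?occ k t)"
      using sum_trees_occ[OF t] sum_split_at[OF K, of "\<lambda>k. ?occ k t"] by linarith
    then have "real ?N - (\<Sum>k=1..K. ?occ k t) - (\<Sum>k=K+1..?N. ?prs k t) =
        (\<Sum>k=K+1..?N. \<Sum>s\<in>trees m k. real (occ s t) - real (occ s t choose 2))"
      by (simp only: sum_subtractf)
    also have "\<dots> \<le> (\<Sum>k=K+1..?N. \<Sum>s\<in>trees m k. of_bool (occ s t > 0))"
      by (intro sum_mono occ_le)
    also have "\<dots> \<le> (\<Sum>k=1..K. \<Sum>s\<in>trees m k. of_bool (occ s t > 0))
        + (\<Sum>k=K+1..?N. \<Sum>s\<in>trees m k. of_bool (occ s t > 0))"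
      by (simp add: sum_nonneg)
    also have "\<dots> = real (dag_nodes t)"
      unfolding dag_nodes_eq_sum[OF t] by (rule sum_split_at[OF K, symmetric])
    finally show ?thesis .
  qed
  have "mean_trees m ?N (\<lambda>t. real ?N - (\<Sum>k=1..K. ?occ k t) - (\<Sum>k=K+1..?N. ?prs k t)) \<le>
      mean_trees m ?N (\<lambda>t. real (dag_nodes t))"
    by (rule mean_trees_mono) (rule dag_ge)
  then have "avg_dag_nodes m n \<ge> real ?N - (\<Sum>k=1..K. mean_trees m ?N (?occ k))
      - (\<Sum>k=K+1..?N. mean_trees m ?N (?prs k))"
    using assms(1) by (simp only: avg_dag_nodes_eq mean_trees_diff mean_trees_sum mean_trees_const zero_less_Suc)
  moreover have "(\<Sum>k=1..K. mean_trees m ?N (?occ k)) \<le>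
      (real ?N + 1) * (real ?N / (real ?N - real K)) * (1 - 2 * ?w)"
  proof -
    have "mean_trees m ?N (?occ k) \<le>
        (real ?N + 1) * (real ?N / (real ?N - real K)) * (wallis_ratio k / (real k + 1))"
      if k: "k \<in> {1..K}" for k
    proof -
      have "(real ?N - real K) * wallis_ratio (?N - k) \<le> real (?N - k) * wallis_ratio (?N - k)"
        using k K wallis_ratio_pos[of "?N - k"] by (intro mult_right_mono) auto
      also have "\<dots> \<le> real ?N * wallis_ratio ?N"
        using incseqD[OF incseq_times_wallis_ratio, of "?N - k" ?N] by simp
      finally have "wallis_ratio (?N - k) / wallis_ratio ?N \<le> real ?N / (real ?N - real K)"
        using assms(2) wallis_ratio_pos[of ?N] by (simp add: divide_simps mult.commute)
      then have "(real ?N + 1) * (wallis_ratio k / (real k + 1)) * (wallis_ratio (?N - k) / wallis_ratio ?N)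
        \<le> (real ?N + 1) * (wallis_ratio k / (real k + 1)) * (real ?N / (real ?N - real K))"
        using wallis_ratio_pos[of k] by (intro mult_left_mono) auto
      then show ?thesis using k K assms(1) by (subst mean_occ) (auto simp: mult_ac)
    qed
    then have "(\<Sum>k=1..K. mean_trees m ?N (?occ k)) \<le>
        (\<Sum>k=1..K. (real ?N + 1) * (real ?N / (real ?N - real K)) * (wallis_ratio k / (real k + 1)))"
      by (rule sum_mono)
    then show ?thesis by (simp only: sum_distrib_left[symmetric] sum_wallis_ratio)
  qed
  moreover have "(\<Sum>k=K+1..?N. mean_trees m ?N (?prs k)) \<le> 2 * real ?N * ?w / (real K + 1)"
  proof -
    let ?c = "(real ?N + 1) * real ?N / 2 * (?w / (real K + 1))" and ?x = "1 / (4 * real m)"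
    have "mean_trees m ?N (?prs k) \<le> ?c * ?x ^ k" if k: "k \<in> {K+1..?N}" for k
    proof -
      have "mean_trees m ?N (?prs k) \<le> (real ?N + 1) * real ?N / 2 * (wallis_ratio k / (real k + 1)) * ?x ^ k"
        using k assms(1) by (intro mean_occ_pairs_le) auto
      also have "\<dots> \<le> ?c * ?x ^ k"
        using k decseqD[OF decseq_wallis_ratio, of "Suc K" k] wallis_ratio_pos[of "Suc K"]
        by (intro mult_right_mono mult_left_mono frac_le) auto
      finally show ?thesis .
    qed
    then have "(\<Sum>k=K+1..?N. mean_trees m ?N (?prs k)) \<le> (\<Sum>k=K+1..?N. ?c * ?x ^ k)"
      by (rule sum_mono)
    also have "\<dots> = ?c * (\<Sum>k=K+1..?N. ?x ^ k)"
      by (simp only: sum_distrib_left)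
    also have "\<dots> \<le> ?c * (2 / real ?N)"
    proof (rule mult_left_mono)
      have "(\<Sum>k=K+1..?N. ?x ^ k) \<le> 2 * ?x ^ (K + 1) - ?x ^ ?N"
        using assms by (intro sum_power_le) (auto simp: field_simps)
      also have "\<dots> \<le> 2 * ?x ^ Suc K" by simp
      also have "?x ^ Suc K \<le> 1 / real ?N"
        using assms(3) by (simp only: power_one_over) (rule frac_le, auto)
      finally show "(\<Sum>k=K+1..?N. ?x ^ k) \<le> 2 / real ?N" by simp
      show "?c \<ge> 0" using wallis_ratio_pos[of "Suc K"] by simp
    qed
    also have "\<dots> = (real ?N + 1) * (?w / (real K + 1))"
      by (simp add: divide_simps)
    also have "\<dots> \<le> (2 * real ?N) * (?w / (real K + 1))"
      using wallis_ratio_pos[of "Suc K"] by (intro mult_right_mono) auto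
    finally show ?thesis by simp
  qed
  \<comment> \<open>With d = N - K and w = b_{K+1} the right side equals 2Nw (N+1)/d - N (K+1)/d.
    The last term lacks the factor w and is absorbed through 1 <= 2w (K+1), which accounts for the
    square.\<close>
  moreover have "2 * real ?N * ?w - 2 * real ?N * ?w * ((real K + 1)\<^sup>2 / (real ?N - real K)) \<le>
     real ?N - (real ?N + 1) * (real ?N / (real ?N - real K)) * (1 - 2 * ?w)"
  proof -
    define d where "d = real ?N - real K"
    have d: "d > 0" "real ?N = d + real K" using assms(2) by (simp_all add: d_def)
    have "1 \<le> 2 * ?w * (real K + 1)"
      using wallis_ratio_ge[of K] by (simp add: pos_divide_le_eq algebra_simps)
    then have "real ?N * (real K + 1) * 1 \<le> real ?N * (real K + 1) * (2 * ?w * (real K + 1))"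
      by (intro mult_left_mono) auto
    then have "real ?N * (real K + 1) * 1 / d \<le> real ?N * (real K + 1) * (2 * ?w * (real K + 1)) / d"
      using d(1) by (intro divide_right_mono) auto
    also have "\<dots> = 2 * real ?N * ?w * ((real K + 1)\<^sup>2 / d)"
      using d(1) by (simp add: power2_eq_square divide_simps del: of_nat_Suc)
    finally have 1: "real ?N * (real K + 1) / d \<le> 2 * real ?N * ?w * ((real K + 1)\<^sup>2 / d)"
      by simp
    have "2 * real ?N * ?w \<le> 2 * real ?N * ?w * ((real ?N + 1) / d)"
      using d wallis_ratio_pos[of "Suc K"]
        mult_left_mono[of 1 "(real ?N + 1) / d" "2 * real ?N * ?w"] by (simp del: of_nat_Suc)
    moreover have "real ?N - (real ?N + 1) * (real ?N / d) * (1 - 2 * ?w) =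
        2 * real ?N * ?w * ((real ?N + 1) / d) - real ?N * (real K + 1) / d"
      using d(1) unfolding d(2) by (simp add: field_simps)
    ultimately show ?thesis using 1 unfolding d_def[symmetric] by linarith
  qed
  ultimately show ?thesis
    by (simp add: right_diff_distrib)
qed

section \<open>Choice of the cutoff and comparison with the asymptotic term\<close>

text \<open>Applied with L = ln (4m), y = ln n and z = ln (n+1), so that K is the integer part of z
  / L. Both bounds come from r^2: the upper one gives r <= 1, hence r >= r^2, and r^2 is at least (y
  / L) / (K + 3/2).\<close>

lemma normalised_wallis_ratio_bounds:
  fixes L y z :: real
  assumes "L > 0" "0 < y" "y \<le> z" "real K * L \<le> z" "z < (real K + 1) * L"
  defines "r \<equiv> wallis_ratio (Suc K) * sqrt y / sqrt (L / pi)"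
  shows "r \<le> 1" "y / (z + 2 * L) \<le> r"
proof -
  let ?w = "wallis_ratio (Suc K)"
  have r2: "r\<^sup>2 = ?w\<^sup>2 * pi * (y / L)"
    using assms(1,2) by (simp add: r_def power_divide power_mult_distrib)
  have r0: "r \<ge> 0"
    using assms(1,2) wallis_ratio_pos[of "Suc K"] by (simp add: r_def)
  have "y / L \<le> real K + 1"
    using assms by (simp add: pos_divide_le_eq)
  then have "r\<^sup>2 \<le> ?w\<^sup>2 * pi * (real K + 1)"
    unfolding r2 by (intro mult_left_mono) auto
  also have "\<dots> \<le> 1"
    using wallis_ratio_square_le[of "Suc K"] by (simp add: pos_le_divide_eq mult_ac add_ac)
  finally show r1: "r \<le> 1"
    by (simp add: abs_square_le_1)
  have "y / (z + 2 * L) \<le> y / ((real K + 3/2) * L)"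
  proof (intro divide_left_mono mult_pos_pos)
    show "(real K + 3/2) * L \<le> z + 2 * L"
      using assms by (simp add: algebra_simps)
  qed (use assms in auto)
  also have "\<dots> = 1 / (real K + 3/2) * (y / L)"
    by simp
  also have "\<dots> \<le> ?w\<^sup>2 * pi * (y / L)"
    using wallis_ratio_square_ge[of "Suc K"] assms
    by (intro mult_right_mono) (simp_all add: field_simps)
  also have "\<dots> \<le> r"
    unfolding r2[symmetric] using r0 r1 by (simp add: power2_eq_square mult_left_le)
  finally show "y / (z + 2 * L) \<le> r" .
qed

text \<open>Eliminates K: both bounds are explicit elementary functions of n, whose asymptotics can
  be computed mechanically.\<close>

lemma avg_dag_nodes_normalised_bounds:
  fixes m n :: nat
  assumes "m \<ge> 1" "n \<ge> 4 * m"
  defines "L \<equiv> ln (4 * real m)"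
  defines "\<kappa> \<equiv> sqrt (L / pi)" and "z \<equiv> ln (real n + 1)"
  defines "A \<equiv> avg_dag_nodes m n / (2 * \<kappa> * real n / sqrt (ln (real n)))"
  defines "e \<equiv> (z + 1)\<^sup>2 / (real n + 1 - z) + L / z"
  shows "A \<le> (1 + 1 / real n) * (1 + 1 / real n + 2 * L / ln (real n))"
    and "e \<le> 1 \<Longrightarrow> (1 - e) * (ln (real n) / (z + 2 * L)) \<le> A"
proof -
  let ?N = "Suc n"
  have N: "real ?N = real n + 1" by simp
  obtain K where K0: "(4 * m) ^ K \<le> ?N" "?N < (4 * m) ^ (K + 1)"
    using ex_power_ivl1[of "4 * m" ?N] assms(1) by auto
  have "real ((4 * m) ^ K) \<le> real ?N" "real ?N < real ((4 * m) ^ (K + 1))"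
    using K0 by (simp_all only: of_nat_le_iff of_nat_less_iff)
  then have K: "(4 * real m) ^ K \<le> real ?N" "real ?N < (4 * real m) ^ Suc K"
    by simp_all
  \<comment> \<open>K = 0 would mean n + 1 < 4m.\<close>
  have K1: "K \<ge> 1"
    using K0(2) assms(2) by (cases K) auto
  \<comment> \<open>Since e < 4, L exceeds 1, which turns K L <= z into K <= z.\<close>
  have e_less: "exp (1::real) < 4" using e_less_272 by simp
  have "ln (exp 1) < ln (4 * real m)"
    using assms(1) e_less by (subst ln_less_cancel_iff) auto
  then have L1: "1 < L" by (simp add: L_def)
  have n: "n \<ge> 4" using assms(1,2) by linarith
  have y0: "0 < ln (real n)" using n by simp
  have yz: "ln (real n) \<le> z" using n by (simp add: z_def)
  have zK: "real K * L \<le> z"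
  proof -
    have "ln ((4 * real m) ^ K) \<le> ln (real ?N)"
      using K(1) assms(1) by (subst ln_le_cancel_iff) auto
    then show ?thesis using assms(1) by (simp only: ln_realpow L_def z_def) (simp add: add.commute)
  qed
  have Kz: "z < (real K + 1) * L"
  proof -
    have "ln (real ?N) < ln ((4 * real m) ^ Suc K)"
      using K(2) assms(1) by (subst ln_less_cancel_iff) auto
    then show ?thesis using assms(1) by (simp only: ln_realpow L_def z_def) (simp add: add.commute)
  qed
  have "real K * 1 \<le> real K * L" using L1 by (intro mult_left_mono) auto
  then have Kle: "real K \<le> z" using zK by simp
  have zn: "z < real n + 1" 
    unfolding z_def using ln_less_self[of "real n + 1"] by simp
  then have KN: "K < ?N" using Kle by linarith
  define w where "w = wallis_ratio (Suc K)"
  define r where "r = w * sqrt (ln (real n)) / \<kappa>"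
  have r: "r \<le> 1" "ln (real n) / (z + 2 * L) \<le> r"
    unfolding r_def \<kappa>_def w_def
    by (rule normalised_wallis_ratio_bounds[OF less_trans[OF zero_less_one L1] y0 yz zK Kz])+
  have \<kappa>: "\<kappa> > 0"
    using L1 by (simp add: \<kappa>_def)
  have r0: "0 \<le> r"
    using \<kappa> y0 wallis_ratio_pos[of "Suc K"] by (simp add: r_def w_def)
  \<comment> \<open>Trades the square roots for r and w, so that a bound 2 N w c on the average
    becomes (1 + 1/n) r c.\<close>
  have A: "A = avg_dag_nodes m n * (r / (2 * real n * w))"
    using wallis_ratio_pos[of "Suc K"] by (simp add: A_def r_def w_def)
  have "real ?N / real n = 1 + 1 / real n"
    using n by (simp add: add_divide_distrib)
  moreover have "2 * real ?N * w * c * (r / (2 * real n * w)) = real ?N / real n * r * c" for c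
    using wallis_ratio_pos[of "Suc K"] by (simp add: w_def del: of_nat_Suc)
  ultimately have scale: "2 * real ?N * w * c * (r / (2 * real n * w)) = (1 + 1 / real n) * r * c" for c
    by (simp only:)
  have fac: "r / (2 * real n * w) \<ge> 0"
    using r0 wallis_ratio_pos[of "Suc K"] by (simp add: w_def)
  have LK: "1 / (real K + 1) \<le> L / z"
    using Kz y0 yz by (simp add: divide_simps mult.commute)
  show "A \<le> (1 + 1 / real n) * (1 + 1 / real n + 2 * L / ln (real n))"
  proof -
    let ?c = "1 + 1 / real ?N + 2 / (real K + 1)"
    have "A \<le> (2 * real ?N * w * ?c) * (r / (2 * real n * w))"
      unfolding A using avg_dag_nodes_le[OF assms(1) K1 less_imp_le[OF KN] K(1)] fac
      unfolding w_def by (rule mult_right_mono)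
    also have "\<dots> = (1 + 1 / real n) * r * ?c" by (rule scale)
    also have "\<dots> \<le> (1 + 1 / real n) * 1 * (1 + 1 / real n + 2 * L / ln (real n))"
    proof (intro mult_mono)
      have "L / z \<le> L / ln (real n)"
        using y0 yz L1 by (intro divide_left_mono mult_pos_pos) auto
      then have "2 / (real K + 1) \<le> 2 * L / ln (real n)" using LK by simp
      moreover have "1 / real ?N \<le> 1 / real n" using n by (simp add: divide_simps)
      ultimately show "?c \<le> 1 + 1 / real n + 2 * L / ln (real n)" by linarith
    qed (use r r0 in auto)
    finally show ?thesis by simp
  qed
  show "(1 - e) * (ln (real n) / (z + 2 * L)) \<le> A" if "e \<le> 1"
  proof -
    let ?c = "1 - (real K + 1)\<^sup>2 / (real ?N - real K) - 1 / (real K + 1)"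
    have "(real K + 1)\<^sup>2 / (real ?N - real K) \<le> (z + 1)\<^sup>2 / (real n + 1 - z)"
      using Kle zn by (intro frac_le power_mono) auto
    then have c: "1 - e \<le> ?c" using LK by (simp add: e_def)
    \<comment> \<open>The condition on e makes 1 - e nonnegative, so the lower bound on r may be
      multiplied by it.\<close>
    have "(1 - e) * (ln (real n) / (z + 2 * L)) \<le> (1 - e) * r"
      using that r(2) by (intro mult_left_mono) auto
    also have "\<dots> \<le> (1 - e) * ((1 + 1 / real n) * r)"
      using that r0 by (intro mult_left_mono) (auto simp: algebra_simps)
    also have "\<dots> \<le> ?c * ((1 + 1 / real n) * r)"
      using c r0 by (intro mult_right_mono) auto
    also have "\<dots> = (1 + 1 / real n) * r * ?c"
      by (rule mult.commute)
    also have "\<dots> = (2 * real ?N * w * ?c) * (r / (2 * real n * w))"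
      by (rule scale[symmetric])
    also have "\<dots> \<le> A"
      unfolding A using avg_dag_nodes_ge[OF assms(1) KN less_imp_le[OF K(2)]] fac
      unfolding w_def by (rule mult_right_mono)
    finally show ?thesis .
  qed
qed

section \<open>Conclusion in Landau notation\<close>

text \<open>Whatever the signs, f <= a <= g forces |a| <= |f| + |g|.\<close>

lemma bigo_sandwich:
  fixes f g h :: "nat \<Rightarrow> real"
  assumes "f \<in> O(h)" "g \<in> O(h)" "eventually (\<lambda>n. f n \<le> a n \<and> a n \<le> g n) sequentially"
  shows "a \<in> O(h)"
proof -
  have "(\<lambda>n. \<bar>f n\<bar> + \<bar>g n\<bar>) \<in> O(h)"
    using assms(1,2) by (intro sum_in_bigo) simp_all
  moreover have "a \<in> O(\<lambda>n. \<bar>f n\<bar> + \<bar>g n\<bar>)"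
    by (rule bigoI[of _ 1]) (use assms(3) in \<open>auto elim!: eventually_mono\<close>)
  ultimately show ?thesis by (rule landau_o.big_trans[rotated])
qed

theorem theorem6:
  fixes m :: nat
  assumes "m \<ge> 1"
  defines "\<kappa> \<equiv> sqrt (ln (4 * real m) / pi)"
  shows "(\<lambda>n::nat. avg_dag_nodes m n / (2 * \<kappa> * real n / sqrt (ln (real n))) - 1)
           \<in> O(\<lambda>n. 1 / ln (real n))"
proof -
  define L where "L = ln (4 * real m)"
  have L: "L > 0" using assms(1) by (simp add: L_def)
  let ?e = "\<lambda>n. (ln (real n + 1) + 1)\<^sup>2 / (real n + 1 - ln (real n + 1)) + L / ln (real n + 1)"
  let ?l = "\<lambda>n. (1 - ?e n) * (ln (real n) / (ln (real n + 1) + 2 * L)) - 1"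
  let ?u = "\<lambda>n. (1 + 1 / real n) * (1 + 1 / real n + 2 * L / ln (real n)) - 1"
  show ?thesis
  proof (rule bigo_sandwich)
    show "?l \<in> O(\<lambda>n. 1 / ln (real n))" using L by real_asymp
    show "?u \<in> O(\<lambda>n. 1 / ln (real n))" using L by real_asymp
    have "eventually (\<lambda>n. ?e n \<le> 1) sequentially" using L by real_asymp
    then show "eventually (\<lambda>n. ?l n \<le> avg_dag_nodes m n / (2 * \<kappa> * real n / sqrt (ln (real n))) - 1 \<and>
        avg_dag_nodes m n / (2 * \<kappa> * real n / sqrt (ln (real n))) - 1 \<le> ?u n) sequentially"
      using eventually_ge_at_top[of "4 * m"]
    proof eventually_elim
      case (elim n)
      then show ?case
        using avg_dag_nodes_normalised_bounds[OF assms(1) elim(2)]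
        unfolding L_def \<kappa>_def by simp
    qed
  qed
qed

end
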